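(* Let $k \geq 3$ be an integer. Then: (a) for every $A \subseteq \mathbb{N}$, if $D^k(A)$ is dense in $S^{k-1}$, then $D^{k-1}(A)$ is dense in $S^{k-2}$; (b) there exists $A \subseteq \mathbb{N}$ such that $D^k(A)$ is not dense in $S^{k-1}$ but $D^{k-1}(A)$ is dense in $S^{k-2}$.
   Context: $\mathbb{N}$ denotes the set of positive integers and $\|\cdot\|$ the Euclidean norm. For every integer $m \geq 2$, put $S^{m-1} := \{\boldsymbol{x} \in [0,1]^m : \|\boldsymbol{x}\| = 1\}$ (the part of the unit sphere of $\mathbb{R}^m$ with nonnegative coordinates), with the subspace topology from $\mathbb{R}^m$, and for $A \subseteq \mathbb{N}$ put $D^m(A) := \{\boldsymbol{a}/\|\boldsymbol{a}\| : \boldsymbol{a} \in A^m\} \subseteq S^{m-1}$. *)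

theory Defs
  imports "HOL-Analysis.Analysis"
begin

text \<open>
  A point of \<open>\<real>\<^sup>m\<close> is a function \<open>x :: nat \<Rightarrow> real\<close> with coordinates \<open>x i\<close> for \<open>i < m\<close> and
  \<open>x i = 0\<close> for \<open>i \<ge> m\<close>, so that it is an element of the carrier of the library topology
  \<^term>\<open>Euclidean_space m\<close>; its Euclidean norm is \<^term>\<open>L2_set x {..<m}\<close>.
\<close>

text \<open>The space written \<open>S\<^sup>m\<^sup>-\<^sup>1\<close> mathematically: the index \<open>m\<close> is the dimension of the ambient space.\<close>

definition nonneg_sphere :: "nat \<Rightarrow> (nat \<Rightarrow> real) set" where
  "nonneg_sphere m =
     {x \<in> topspace (Euclidean_space m). (\<forall>i<m. x i \<in> {0..1}) \<and> L2_set x {..<m} = 1}"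

definition sphere_topology :: "nat \<Rightarrow> (nat \<Rightarrow> real) topology" where
  "sphere_topology m = subtopology (Euclidean_space m) (nonneg_sphere m)"

text \<open>
  \<open>A\<^sup>m\<close> is represented by the sequences with entries in \<open>A\<close> at the indices below \<open>m\<close> and
  zeros elsewhere, whether or not \<open>0 \<in> A\<close>.
\<close>

definition tuples :: "nat \<Rightarrow> nat set \<Rightarrow> (nat \<Rightarrow> real) set" where
  "tuples m A = {a. (\<forall>i<m. a i \<in> real ` A) \<and> (\<forall>i\<ge>m. a i = 0)}"

definition direction_set :: "nat \<Rightarrow> nat set \<Rightarrow> (nat \<Rightarrow> real) set" where
  "direction_set m A = {(\<lambda>i. a i / L2_set a {..<m}) | a. a \<in> tuples m A}"

definition dense_in_space :: "'a topology \<Rightarrow> 'a set \<Rightarrow> bool" where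
  "dense_in_space X D \<longleftrightarrow> X closure_of D = topspace X"

lemma topspace_sphere_topology: "topspace (sphere_topology m) = nonneg_sphere m"
  by (auto simp: sphere_topology_def nonneg_sphere_def)

lemma direction_set_subset:
  assumes "m > 0" "A \<subseteq> {1..}"
  shows "direction_set m A \<subseteq> topspace (sphere_topology m)"
proof
  fix x assume "x \<in> direction_set m A"
  then obtain a where a: "a \<in> tuples m A" and x: "x = (\<lambda>i. a i / L2_set a {..<m})"
    by (auto simp: direction_set_def)
  have pos: "a i \<ge> 1" if "i < m" for i
    using a that assms(2) by (force simp: tuples_def)
  have le: "a i \<le> L2_set a {..<m}" if "i < m" for i
    using that by (intro member_le_L2_set) auto
  have N: "L2_set a {..<m} > 0"
    using pos[of 0] le[of 0] assms(1) by linarith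
  have "x i \<in> {0..1}" if "i < m" for i
    using pos[OF that] le[OF that] N by (simp add: x)
  moreover have "x i = 0" if "i \<ge> m" for i
    using a that by (simp add: x tuples_def)
  moreover have "L2_set x {..<m} = 1"
    using L2_set_right_distrib[of "inverse (L2_set a {..<m})" a "{..<m}"] N
    by (simp add: x divide_inverse mult.commute)
  ultimately show "x \<in> topspace (sphere_topology m)"
    by (simp add: topspace_sphere_topology nonneg_sphere_def topspace_Euclidean_space)
qed

end

theory Submission
  imports Defs
begin

text \<open>
  (a) A point \<open>x\<close> of the smaller sphere, extended by a zero coordinate, lies on the larger one;
  dropping the last coordinate from directions converging to it and normalising again gives
  directions converging to \<open>x\<close>.

  (b) Put \<open>m = k - 1\<close>. Enumerate all positive integer \<open>m\<close>-tuples, multiply each by its own scale, and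
  let \<open>A\<close> collect the entries. Scaling does not change directions, so \<open>D\<^sup>m(A)\<close> contains every
  rational direction. If the scales grow fast enough, two entries from different blocks differ by
  a factor of at least 3, whereas \<open>m + 1\<close> entries from one block cannot be distinct. Hence
  \<open>D\<^sup>m\<^sup>+\<^sup>1(A)\<close> misses the open set of points whose coordinates are distinct and within a factor
  of 3 of each other.
\<close>

section \<open>Density and limits of directions in the product topology\<close>

text \<open>\<open>Euclidean_space m\<close> is a subspace of the product topology, hence so is the
  sphere; as the directions lie on the sphere, density reduces to a type-class
  \<open>closure\<close>.\<close>

lemma dense_in_sphere_iff:
  assumes "m > 0" "A \<subseteq> {1..}"
  shows "dense_in_space (sphere_topology m) (direction_set m A) \<longleftrightarrow>
         nonneg_sphere m \<subseteq> closure (direction_set m A)"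
proof -
  have "sphere_topology m = top_of_set (nonneg_sphere m)"
  proof -
    have "{x. \<forall>i\<ge>m. x i = 0} \<inter> nonneg_sphere m = nonneg_sphere m"
      by (auto simp: nonneg_sphere_def topspace_Euclidean_space)
    then show ?thesis
      by (simp add: sphere_topology_def Euclidean_space_def subtopology_subtopology
          euclidean_product_topology)
  qed
  moreover have "direction_set m A \<subseteq> nonneg_sphere m"
    using direction_set_subset[OF assms] by (simp add: topspace_sphere_topology)
  ultimately show ?thesis
    by (auto simp: dense_in_space_def closure_of_subtopology Int_absorb1)
qed

lemma tendsto_fun_iff:
  fixes f :: "'b \<Rightarrow> 'a \<Rightarrow> 'c::topological_space"
  shows "(f \<longlongrightarrow> l) F \<longleftrightarrow> (\<forall>i. ((\<lambda>n. f n i) \<longlongrightarrow> l i) F)"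
  using limitin_componentwise[of "\<lambda>_. euclidean" UNIV f l F]
  by (simp add: euclidean_product_topology)

text \<open>The scaling \<open>c n\<close> may differ from the norm of \<open>a n\<close>: the limit
  \<open>x\<close> has norm 1, so by continuity the ratio of the two tends to 1.\<close>

lemma direction_set_closureI:
  assumes a: "\<And>n. a n \<in> tuples m A" and c: "\<And>n. c n > 0"
    and lim: "\<And>i. i < m \<Longrightarrow> (\<lambda>n. a n i / c n) \<longlonglongrightarrow> x i"
    and x: "x \<in> nonneg_sphere m"
  shows "x \<in> closure (direction_set m A)"
proof -
  let ?N = "\<lambda>n. L2_set (a n) {..<m} / c n"
  have x1: "L2_set x {..<m} = 1" and x0: "\<And>i. i \<ge> m \<Longrightarrow> x i = 0"
    using x by (auto simp: nonneg_sphere_def topspace_Euclidean_space)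
  have "?N n = L2_set (\<lambda>i. a n i / c n) {..<m}" for n
    using L2_set_left_distrib[of "inverse (c n)" "a n" "{..<m}"] c[of n]
    by (simp add: divide_inverse)
  moreover have "(\<lambda>n. L2_set (\<lambda>i. a n i / c n) {..<m}) \<longlonglongrightarrow> L2_set x {..<m}"
    unfolding L2_set_def by (intro tendsto_intros lim) auto
  ultimately have N: "?N \<longlonglongrightarrow> 1"
    by (simp add: x1)
  have "(\<lambda>n. a n i / L2_set (a n) {..<m}) \<longlonglongrightarrow> x i" for i
  proof (cases "i < m")
    case True
    have "(\<lambda>n. (a n i / c n) / ?N n) \<longlonglongrightarrow> x i / 1"
      by (intro tendsto_divide lim True N) simp
    moreover have "(a n i / c n) / ?N n = a n i / L2_set (a n) {..<m}" for n
      using less_imp_neq[OF c[of n]] by simp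
    ultimately show ?thesis by (simp only: div_by_1)
  next
    case False
    then show ?thesis using a x0 by (simp add: tuples_def)
  qed
  then have "(\<lambda>n i. a n i / L2_set (a n) {..<m}) \<longlonglongrightarrow> x"
    by (subst tendsto_fun_iff) simp
  moreover have "(\<lambda>i. a n i / L2_set (a n) {..<m}) \<in> direction_set m A" for n
    using a by (auto simp: direction_set_def)
  ultimately show ?thesis
    unfolding closure_sequential by (intro exI conjI allI)
qed

section \<open>Density passes to one dimension lower\<close>

lemma dense_directions_decrease:
  assumes m: "m > 0" and A: "A \<subseteq> {1..}"
    and dense: "nonneg_sphere (Suc m) \<subseteq> closure (direction_set (Suc m) A)"
  shows "nonneg_sphere m \<subseteq> closure (direction_set m A)"
proof
  fix x assume x: "x \<in> nonneg_sphere m"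
  then have "x m = 0" "\<forall>i\<ge>m. x i = 0" "\<forall>i<m. x i \<in> {0..1}" "L2_set x {..<m} = 1"
    by (auto simp: nonneg_sphere_def topspace_Euclidean_space)
  \<comment> \<open>With zero padding, appending a zero coordinate leaves the function
    \<open>x\<close> unchanged.\<close>
  then have "x \<in> nonneg_sphere (Suc m)"
    by (auto simp: nonneg_sphere_def topspace_Euclidean_space L2_set_def less_Suc_eq)
  then have "x \<in> closure (direction_set (Suc m) A)"
    using dense by blast
  then obtain y where y: "\<And>n. y n \<in> direction_set (Suc m) A" "y \<longlonglongrightarrow> x"
    by (auto simp: closure_sequential)
  then have "\<forall>n. \<exists>a. a \<in> tuples (Suc m) A \<and> y n = (\<lambda>i. a i / L2_set a {..<Suc m})"
    by (auto simp: direction_set_def)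
  then obtain a where a: "\<And>n. a n \<in> tuples (Suc m) A"
    and y_eq: "\<And>n. y n = (\<lambda>i. a n i / L2_set (a n) {..<Suc m})"
    by metis
  show "x \<in> closure (direction_set m A)"
  proof (rule direction_set_closureI[OF _ _ _ x])
    \<comment> \<open>The truncated tuples are still scaled by the norms of the full ones, so the
      quotients are coordinates of \<open>y n\<close>, which converge.\<close>
    show "(\<lambda>i. if i < m then a n i else 0) \<in> tuples m A" for n
      using a[of n] by (auto simp: tuples_def)
    show "L2_set (a n) {..<Suc m} > 0" for n
    proof -
      have "a n 0 > 0"
        using a[of n] A by (force simp: tuples_def)
      moreover have "a n 0 \<le> L2_set (a n) {..<Suc m}"
        by (rule member_le_L2_set) auto
      ultimately show ?thesis by linarith
    qed
    show "(\<lambda>n. (if i < m then a n i else 0) / L2_set (a n) {..<Suc m}) \<longlonglongrightarrow> x i" if "i < m" for i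
      using y(2) that by (simp add: tendsto_fun_iff y_eq)
  qed
qed

section \<open>A set dense in directions of one dimension but not of the next\<close>

lemma positive_directions_dense: "nonneg_sphere m \<subseteq> closure (direction_set m {1..})"
proof
  fix x assume x: "x \<in> nonneg_sphere m"
  \<comment> \<open>Rounding down and adding 1 keeps entries positive even where
    \<open>x i = 0\<close>; the error is at most 1, which vanishes after division by
    \<open>Suc n\<close>.\<close>
  define a where "a n i = (if i < m then real (Suc (nat \<lfloor>real (Suc n) * x i\<rfloor>)) else 0)" for n i
  show "x \<in> closure (direction_set m {1..})"
  proof (rule direction_set_closureI[OF _ _ _ x])
    show "a n \<in> tuples m {1..}" for n
      by (auto simp: tuples_def a_def simp del: of_nat_Suc)
    show "real (Suc n) > 0" for n by simp
    show "(\<lambda>n. a n i / real (Suc n)) \<longlonglongrightarrow> x i" if "i < m" for i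
    proof (rule real_tendsto_sandwich)
      have "x i \<ge> 0" using x that by (auto simp: nonneg_sphere_def)
      then have "0 \<le> x i * real (Suc n)" for n by simp
      then have bounds: "x i * real (Suc n) \<le> a n i" "a n i \<le> x i * real (Suc n) + 1" for n
        using that real_of_int_floor_add_one_ge[of "x i * real (Suc n)"]
          of_int_floor_le[of "x i * real (Suc n)"]
        unfolding a_def mult.commute[of _ "x i"] of_nat_Suc[of "nat _"]
        by (simp_all add: add.commute del: of_nat_Suc)
      have "x i \<le> a n i / real (Suc n)" "a n i / real (Suc n) \<le> x i + 1 / real (Suc n)" for n
        using divide_right_mono[OF bounds(1)[of n], of "real (Suc n)"]
          divide_right_mono[OF bounds(2)[of n], of "real (Suc n)"]
        by (auto simp: add_divide_distrib simp del: of_nat_Suc)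
      then show "\<forall>\<^sub>F n in sequentially. x i \<le> a n i / real (Suc n)"
        and "\<forall>\<^sub>F n in sequentially. a n i / real (Suc n) \<le> x i + 1 / real (Suc n)"
        by simp_all
      show "(\<lambda>n. x i) \<longlonglongrightarrow> x i" by simp
      show "(\<lambda>n. x i + 1 / real (Suc n)) \<longlonglongrightarrow> x i"
        using tendsto_add[OF tendsto_const LIMSEQ_inverse_real_of_nat, of "x i"]
        by (simp add: divide_inverse)
    qed
  qed
qed

text \<open>
  Indices beyond the length of the decoded list give unspecified values, which only add further
  positive integers to the blocks.
\<close>

definition entry :: "nat \<Rightarrow> nat \<Rightarrow> nat" where
  "entry n i = Suc (from_nat n ! i)"

primrec block_scale :: "nat \<Rightarrow> nat \<Rightarrow> nat" where
  "block_scale m 0 = 1"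
| "block_scale m (Suc n) = 3 * block_scale m n * Suc (\<Sum>i<m. entry n i)"

definition block :: "nat \<Rightarrow> nat \<Rightarrow> nat set" where
  "block m n = (\<lambda>i. block_scale m n * entry n i) ` {..<m}"

lemma entry_surj:
  fixes f :: "nat \<Rightarrow> nat"
  assumes "\<And>i. i < m \<Longrightarrow> f i > 0"
  obtains n where "\<And>i. i < m \<Longrightarrow> entry n i = f i"
proof
  \<comment> \<open>The coded list stores \<open>f i - 1\<close> because \<open>entry\<close> adds 1
    back.\<close>
  show "entry (to_nat (map (\<lambda>i. f i - 1) [0..<m])) i = f i" if "i < m" for i
    using assms[OF that] that by (simp add: entry_def)
qed

lemma block_scale_pos: "block_scale m n > 0"
  by (induction n) auto

lemma block_scale_mono: "n \<le> n' \<Longrightarrow> block_scale m n \<le> block_scale m n'"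
  by (rule lift_Suc_mono_le) auto

text \<open>The sum in \<open>block_scale\<close> dominates every entry of block \<open>n\<close>,
  so the recursion puts \<open>3 * a\<close> below the next scale. Scales are monotone, and entries
  of at least 1 keep \<open>b\<close> above its own scale.\<close>

lemma blocks_far_apart:
  assumes "a \<in> block m n" "b \<in> block m n'" "n < n'"
  shows "3 * a \<le> b"
proof -
  obtain i j where i: "i < m" "a = block_scale m n * entry n i" and b: "b = block_scale m n' * entry n' j"
    using assms by (auto simp: block_def)
  have "entry n i \<le> (\<Sum>i<m. entry n i)"
    using i by (intro member_le_sum) auto
  then have "block_scale m n * entry n i \<le> block_scale m n * Suc (\<Sum>i<m. entry n i)"
    by (intro mult_left_mono) auto
  then have "3 * a \<le> block_scale m (Suc n)"
    by (simp add: i)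
  also have "\<dots> \<le> block_scale m n'"
    using assms by (intro block_scale_mono) simp
  also have "\<dots> \<le> b"
    by (simp add: b entry_def)
  finally show ?thesis .
qed

lemma blocks_subset: "(\<Union>n. block m n) \<subseteq> {1..}"
  using block_scale_pos by (auto simp: block_def entry_def Suc_le_eq)

lemma directions_blocks: "direction_set m {1..} \<subseteq> direction_set m (\<Union>n. block m n)"
proof
  fix x assume "x \<in> direction_set m {1..}"
  then obtain a where a: "a \<in> tuples m {1..}" and x: "x = (\<lambda>i. a i / L2_set a {..<m})"
    by (auto simp: direction_set_def)
  then have "\<forall>i. \<exists>f. i < m \<longrightarrow> f > 0 \<and> a i = real f"
    by (force simp: tuples_def)
  then obtain f where f: "\<And>i. i < m \<Longrightarrow> f i > 0" "\<And>i. i < m \<Longrightarrow> a i = real (f i)"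
    by metis
  obtain n where n: "\<And>i. i < m \<Longrightarrow> entry n i = f i"
    using entry_surj f(1) by metis
  define c where "c = real (block_scale m n)"
  have c: "c > 0" using block_scale_pos by (simp add: c_def)
  have "(\<lambda>i. c * a i) \<in> tuples m (\<Union>n. block m n)"
  proof -
    have "c * a i \<in> real ` (\<Union>n. block m n)" if "i < m" for i
    proof (rule image_eqI)
      show "c * a i = real (block_scale m n * entry n i)"
        using that by (simp add: c_def f n)
      show "block_scale m n * entry n i \<in> (\<Union>n. block m n)"
        using that by (auto simp: block_def)
    qed
    then show ?thesis using a by (simp add: tuples_def)
  qed
  moreover have "x = (\<lambda>i. c * a i / L2_set (\<lambda>i. c * a i) {..<m})"
    using c L2_set_right_distrib[of c a "{..<m}", symmetric] by (simp add: x)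
  ultimately show "x \<in> direction_set m (\<Union>n. block m n)"
    unfolding direction_set_def by (intro CollectI exI[of _ "\<lambda>i. c * a i"] conjI)
qed

text \<open>Pigeonhole: a block has at most \<open>m\<close> elements, so \<open>m + 1\<close>
  entries from one block repeat. Otherwise some entry lies in a different block from entry 0, and
  those two are far apart.\<close>

lemma tuple_blocks_gap:
  assumes a: "a \<in> tuples (Suc m) (\<Union>n. block m n)"
  shows "\<exists>i\<le>m. \<exists>j\<le>m. i \<noteq> j \<and> (a i = a j \<or> 3 * a i \<le> a j)"
proof -
  have "\<exists>f n. i \<le> m \<longrightarrow> a i = real f \<and> f \<in> block m n" for i
  proof (cases "i \<le> m")
    case True
    then have "a i \<in> real ` (\<Union>n. block m n)"
      using a by (simp add: tuples_def)
    then show ?thesis by blast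
  qed simp
  then obtain f n where f: "\<And>i. i \<le> m \<Longrightarrow> a i = real (f i)" "\<And>i. i \<le> m \<Longrightarrow> f i \<in> block m (n i)"
    by metis
  show ?thesis
  proof (cases "\<forall>i\<le>m. n i = n 0")
    case True
    have "f ` {..m} \<subseteq> block m (n 0)"
    proof (intro image_subsetI)
      show "f i \<in> block m (n 0)" if "i \<in> {..m}" for i
        using f(2)[of i] that True[rule_format, of i] by simp
    qed
    then have "card (f ` {..m}) \<le> card (block m (n 0))"
      by (intro card_mono) (simp_all add: block_def)
    also have "\<dots> \<le> m"
      unfolding block_def using card_image_le[of "{..<m}"] by simp
    finally have "\<not> inj_on f {..m}"
      by (auto dest: card_image)
    then show ?thesis
      using f(1) unfolding inj_on_def by (metis atMost_iff)
  next
    case False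
    then obtain i where i: "i \<le> m" "n i \<noteq> n 0" by blast
    then have "3 * f i \<le> f 0 \<or> 3 * f 0 \<le> f i"
      using blocks_far_apart f(2) by (meson linorder_neqE_nat zero_le)
    then have "3 * a i \<le> a 0 \<or> 3 * a 0 \<le> a i"
      using i(1) f(1)[of i] f(1)[of 0] by linarith
    moreover have "i \<noteq> 0" using i by metis
    ultimately show ?thesis
      using i by blast
  qed
qed

lemma blocks_not_dense: "\<not> nonneg_sphere (Suc m) \<subseteq> closure (direction_set (Suc m) (\<Union>n. block m n))"
proof
  assume dense: "nonneg_sphere (Suc m) \<subseteq> closure (direction_set (Suc m) (\<Union>n. block m n))"
  \<comment> \<open>A closed set is needed to pass to the closure; the finite unions ensure this.
    Allowing \<open>j = i\<close> would make \<open>C\<close> everything.\<close>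
  define C :: "(nat \<Rightarrow> real) set" where
    "C = (\<Union>i\<in>{..m}. \<Union>j\<in>{..m} - {i}. {x. x i = x j} \<union> {x. 3 * x i \<le> x j})"
  have "closed C"
    unfolding C_def
    by (intro closed_UN ballI closed_Un closed_Collect_eq closed_Collect_le continuous_intros
        continuous_on_product_coordinates) auto
  moreover have "direction_set (Suc m) (\<Union>n. block m n) \<subseteq> C"
  proof
    fix x assume "x \<in> direction_set (Suc m) (\<Union>n. block m n)"
    then obtain a where a: "a \<in> tuples (Suc m) (\<Union>n. block m n)"
      and x: "x = (\<lambda>i. a i / L2_set a {..<Suc m})"
      by (auto simp: direction_set_def)
    obtain i j where ij: "i \<le> m" "j \<le> m" "i \<noteq> j" "a i = a j \<or> 3 * a i \<le> a j"
      using tuple_blocks_gap[OF a] by blast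
    \<comment> \<open>Both alternatives survive division by the nonnegative norm.\<close>
    then have "x i = x j \<or> 3 * x i \<le> x j"
      using divide_right_mono[of "3 * a i" "a j" "L2_set a {..<Suc m}"] by (auto simp: x)
    then show "x \<in> C"
      using ij by (auto simp: C_def)
  qed
  ultimately have sub: "nonneg_sphere (Suc m) \<subseteq> C"
    using dense closure_minimal by blast
  \<comment> \<open>The coordinates \<open>m + 1, ..., 2 * m + 1\<close> are distinct with ratios
    below 2, so \<open>p\<close> violates every condition in \<open>C\<close>.\<close>
  define p where "p i = (if i \<le> m then real (Suc m + i) else 0)" for i
  define q where "q i = p i / L2_set p {..<Suc m}" for i
  have "p \<in> tuples (Suc m) {1..}"
    by (auto simp: tuples_def p_def simp del: of_nat_Suc of_nat_add)
  \<comment> \<open>Being a direction of positive integers already places \<open>q\<close> on the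
    sphere.\<close>
  then have "q \<in> direction_set (Suc m) {1..}"
    by (auto simp: direction_set_def q_def fun_eq_iff)
  then have "q \<in> nonneg_sphere (Suc m)"
    using direction_set_subset[of "Suc m" "{1..}"] by (auto simp: topspace_sphere_topology)
  then have "q \<in> C" using sub by blast
  then obtain i j where ij: "i \<le> m" "j \<le> m" "i \<noteq> j" "q i = q j \<or> 3 * q i \<le> q j"
    by (auto simp: C_def)
  have "p 0 \<le> L2_set p {..<Suc m}"
    by (rule member_le_L2_set) auto
  then have "L2_set p {..<Suc m} > 0"
    by (simp add: p_def)
  then have "p i = p j \<or> 3 * p i \<le> p j"
    using ij(4) by (auto simp: q_def divide_le_cancel)
  then show False
    using ij by (auto simp: p_def)
qed

theorem theorem1p4:
  fixes k :: nat
  assumes "k \<ge> 3"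
  shows "(\<forall>A :: nat set. A \<subseteq> {1..} \<longrightarrow>
            dense_in_space (sphere_topology k) (direction_set k A) \<longrightarrow>
            dense_in_space (sphere_topology (k - 1)) (direction_set (k - 1) A)) \<and>
         (\<exists>A :: nat set. A \<subseteq> {1..} \<and>
            \<not> dense_in_space (sphere_topology k) (direction_set k A) \<and>
            dense_in_space (sphere_topology (k - 1)) (direction_set (k - 1) A))"
proof -
  define m where "m = k - 1"
  have k: "k = Suc m" and m: "m > 0"
    using assms by (auto simp: m_def)
  have "nonneg_sphere m \<subseteq> closure (direction_set m (\<Union>n. block m n))"
    using positive_directions_dense closure_mono[OF directions_blocks] by blast
  then have "\<not> dense_in_space (sphere_topology k) (direction_set k (\<Union>n. block m n)) \<and>
      dense_in_space (sphere_topology m) (direction_set m (\<Union>n. block m n))"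
    using m blocks_subset blocks_not_dense by (simp add: dense_in_sphere_iff k)
  moreover have "dense_in_space (sphere_topology m) (direction_set m A)"
    if "A \<subseteq> {1..}" "dense_in_space (sphere_topology k) (direction_set k A)" for A
    using that m dense_directions_decrease by (simp add: dense_in_sphere_iff k)
  ultimately show ?thesis
    using blocks_subset unfolding m_def by blast
qed

end
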